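(* Assume the Continuum Hypothesis. Then there exists a set $E\subseteq\mathbb{R}$ such that: (1) $E$ is not 2-entangled; (2) $E$ is concentrated on $\mathbb{Q}$, and $E$ is neither a $Q$-set nor a $\lambda$-set; (3) $(E[\leq])^2$ is normal.
   Context: For $X\subseteq\mathbb{R}$, $X[\leq]$ denotes $X$ with the subspace topology inherited from the Sorgenfrey line, i.e. from $\mathbb{R}$ with the topology generated by the half-open intervals $[a,b)$; $(X[\leq])^2$ is the product space $X[\leq]\times X[\leq]$. For $L\subseteq\mathbb{R}$ let $(L)^n$ be the set of all $\langle x_0,\dots,x_{n-1}\rangle\in L^n$ with $x_0<x_1<\dots<x_{n-1}$. $L$ is $n$-entangled if for every set $A\subseteq (L)^n$ of pairwise disjoint $n$-tuples (no two distinct tuples of $A$ share a coordinate) with $|A|=\omega_1$ and every $s\in 2^n$ there are distinct $x,y\in A$ such that for all $i<n$: $x_i<y_i$ if and only if $s_i=0$. $E$ is concentrated on $\mathbb{Q}$ if $E\setminus U$ is countable for every (Euclidean) open set $U\subseteq\mathbb{R}$ with $U\supseteq\mathbb{Q}$. A $Q$-set is an uncountable set $X\subseteq\mathbb{R}$ such that every subset of $X$ is a relative $G_\delta$ (equivalently, every subset is a relative $F_\sigma$) in the Euclidean subspace topology of $X$. A set $X\subseteq\mathbb{R}$ is a $\lambda$-set if every countable subset of $X$ is a relative $G_\delta$ in the Euclidean subspace topology of $X$. *)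

theory Defs
  imports "HOL-Analysis.Analysis"
begin

unbundle cardinal_syntax

text \<open>\<open>natLeq\<close> represents the cardinal $\aleph_0$, so \<open>cardSuc natLeq\<close> represents $\aleph_1 = \omega_1$.\<close>

definition continuum_hypothesis :: bool where
  "continuum_hypothesis \<longleftrightarrow> |UNIV :: real set| =o cardSuc natLeq"

definition sorgenfrey_line :: "real topology" where
  "sorgenfrey_line = topology_generated_by {{a..<b} |a b. True}"

abbreviation sorgenfrey_subspace :: "real set \<Rightarrow> real topology" where
  "sorgenfrey_subspace X \<equiv> subtopology sorgenfrey_line X"

lemma topspace_sorgenfrey_line [simp]: "topspace sorgenfrey_line = UNIV"
proof -
  have "x \<in> \<Union> {{a..<b} |a b. True}" for x :: real
    by (rule UnionI[of "{x..<x + 1}"]) auto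
  then show ?thesis
    unfolding sorgenfrey_line_def topology_generated_by_topspace by blast
qed

text \<open>The set $(L)^n$; an $n$-tuple is a list of length $n$, and \<open>sorted_wrt (<)\<close> says that it is
  strictly increasing.\<close>

definition increasing_tuples :: "real set \<Rightarrow> nat \<Rightarrow> real list set" where
  "increasing_tuples L n = {x. length x = n \<and> set x \<subseteq> L \<and> sorted_wrt (<) x}"

definition entangled :: "nat \<Rightarrow> real set \<Rightarrow> bool" where
  "entangled n L \<longleftrightarrow>
    (\<forall>A \<subseteq> increasing_tuples L n.
      pairwise (\<lambda>x y. disjnt (set x) (set y)) A \<and> |A| =o cardSuc natLeq \<longrightarrow>
      (\<forall>s :: nat list. length s = n \<and> set s \<subseteq> {0, 1} \<longrightarrow>
        (\<exists>x\<in>A. \<exists>y\<in>A. x \<noteq> y \<and> (\<forall>i<n. x ! i < y ! i \<longleftrightarrow> s ! i = 0))))"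

definition concentrated_on :: "real set \<Rightarrow> real set \<Rightarrow> bool" where
  "concentrated_on E D \<longleftrightarrow> (\<forall>U. open U \<and> D \<subseteq> U \<longrightarrow> countable (E - U))"

definition Q_set :: "real set \<Rightarrow> bool" where
  "Q_set X \<longleftrightarrow> uncountable X \<and> (\<forall>Y \<subseteq> X. gdelta_in (top_of_set X) Y)"

definition lambda_set :: "real set \<Rightarrow> bool" where
  "lambda_set X \<longleftrightarrow> (\<forall>Y \<subseteq> X. countable Y \<longrightarrow> gdelta_in (top_of_set X) Y)"

end

theory Submission
  imports Defs "HOL-Library.Countable_Set_Type"
begin

text \<open>The square of \<open>E[\<le>]\<close> is regular, so it is normal once it is Lindelof. A family of boxes
  \<open>[a, a + e) \<times> [b, b + e)\<close>, one at each point \<open>(a, b)\<close> of \<open>E\<^sup>2\<close>, has a countable subfamily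
  covering all points interior to some box, and the remaining points lie on countably many
  closed sets of the plane that contain no two points \<open>p\<close>, \<open>q\<close> with \<open>q\<close> strictly north-east
  of \<open>p\<close>. Under CH a Luzin set \<open>E\<close> can be built that meets every such closed set, up to
  countably many horizontal and vertical lines, in a countable set; lines are harmless because
  the Sorgenfrey line is hereditarily Lindelof. The condition concerns decreasing curves only,
  so \<open>E\<close> can at the same time be invariant under rational translations, which are increasing
  and refute 2-entangledness. A Luzin set is concentrated on each of its countable dense
  subsets, and those are therefore not relative \<open>G\<^sub>\<delta>\<close> sets.\<close>

section \<open>Antitone relations in the plane\<close>

text \<open>Strictness in both coordinates tolerates horizontal and vertical segments. This lets the
  property survive closure, at the price of sections that may have interior.\<close>

definition antitone_rel :: "(real \<times> real) set \<Rightarrow> bool" where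
  "antitone_rel K \<longleftrightarrow> (\<forall>p\<in>K. \<forall>q\<in>K. \<not> (fst p < fst q \<and> snd p < snd q))"

lemma antitone_rel_converse: "antitone_rel (K\<inverse>) \<longleftrightarrow> antitone_rel K"
  unfolding antitone_rel_def by force

text \<open>Lying strictly north-east is an open condition: a corner \<open>(a, b)\<close> strictly
  between \<open>p\<close> and \<open>q\<close> yields two open quadrants, and points of
  \<open>K\<close> in them violate antitonicity.\<close>

lemma antitone_rel_closure:
  assumes "antitone_rel K"
  shows "antitone_rel (closure K)"
  unfolding antitone_rel_def
proof (intro ballI notI, elim conjE)
  fix p q :: "real \<times> real"
  assume p: "p \<in> closure K" and q: "q \<in> closure K"
    and less: "fst p < fst q" "snd p < snd q"
  obtain a b where a: "fst p < a" "a < fst q" and b: "snd p < b" "b < snd q"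
    using less dense by meson
  have "open ({..<a} \<times> {..<b})" "open ({a<..} \<times> {b<..})"
    by (intro open_Times open_lessThan open_greaterThan)+
  moreover have "p \<in> {..<a} \<times> {..<b}" "q \<in> {a<..} \<times> {b<..}"
    using a b by (auto simp: mem_Times_iff)
  ultimately have "{..<a} \<times> {..<b} \<inter> K \<noteq> {}" "{a<..} \<times> {b<..} \<inter> K \<noteq> {}"
    using p q by (metis IntI empty_iff open_Int_closure_eq_empty)+
  then show False
    using assms unfolding antitone_rel_def by fastforce
qed

text \<open>Rational interior points of the sections over \<open>h < k\<close> cannot coincide:
  moving slightly down over \<open>h\<close> would give a point of \<open>K\<close> strictly
  south-west of one over \<open>k\<close>.\<close>

lemma antitone_rel_countable_fat_sections:
  assumes "antitone_rel K"
  shows "countable {h. interior (K `` {h}) \<noteq> {}}" (is "countable ?H")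
proof -
  have "\<exists>q\<in>\<rat>. q \<in> interior (K `` {h})" if h: "h \<in> ?H" for h
  proof -
    obtain y where "y \<in> interior (K `` {h})"
      using h by auto
    then obtain e where e: "e > 0" "ball y e \<subseteq> interior (K `` {h})"
      using open_contains_ball by blast
    obtain q where "q \<in> \<rat>" "y < q" "q < y + e"
      using Rats_dense_in_real[of y "y + e"] e(1) by auto
    then show ?thesis
      using e(2) by (force simp: dist_real_def)
  qed
  then obtain f where f: "\<And>h. h \<in> ?H \<Longrightarrow> f h \<in> \<rat> \<and> f h \<in> interior (K `` {h})"
    by metis
  have neq: "f h \<noteq> f k" if hk: "h \<in> ?H" "k \<in> ?H" "h < k" for h k
  proof
    assume eq: "f h = f k"
    obtain e where e: "e > 0" "ball (f h) e \<subseteq> K `` {h}"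
      using f[OF hk(1)] by (meson mem_interior)
    have "f h - e / 2 \<in> ball (f h) e"
      using e(1) by (simp add: dist_real_def)
    then have "(h, f h - e / 2) \<in> K"
      using e(2) by blast
    moreover have "(k, f k) \<in> K"
      using f[OF hk(2)] interior_subset by blast
    ultimately show False
      using assms eq hk(3) e(1) unfolding antitone_rel_def by fastforce
  qed
  have "inj_on f ?H"
    by (rule inj_onI) (metis neq linorder_neqE)
  moreover have "countable (f ` ?H)"
    using f by (intro countable_subset[OF _ countable_rat]) auto
  ultimately show ?thesis
    using countable_image_inj_on by blast
qed

text \<open>Distinct points of a line of slope 1 are strictly comparable, so such a line meets
  \<open>K\<close> at most once.\<close>

lemma antitone_rel_thin_diagonal:
  assumes "antitone_rel K"
  shows "interior {y. (y + a, y + b) \<in> K} = {}"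
proof -
  have "x = y" if "(x + a, x + b) \<in> K" "(y + a, y + b) \<in> K" for x y
    using assms that unfolding antitone_rel_def by (cases x y rule: linorder_cases) force+
  then have "{y. (y + a, y + b) \<in> K} = {} \<or> (\<exists>x. {y. (y + a, y + b) \<in> K} = {x})"
    by blast
  then show ?thesis
    by auto
qed

section \<open>A Luzin set under the continuum hypothesis\<close>

text \<open>A closed set is coded by the basic open sets in its complement, hence by a set of
  naturals, hence by a real. A recursion along the reals can thus treat every closed set.\<close>

lemma closed_sets_parametrization:
  obtains K :: "real \<Rightarrow> 'a::second_countable_topology set"
  where "\<And>t. closed (K t)" "\<And>C. closed C \<Longrightarrow> \<exists>t. K t = C"
proof -
  obtain B :: "'a set set" where B: "countable B" "\<And>C. C \<in> B \<Longrightarrow> open C"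
    "\<And>S. open S \<Longrightarrow> \<exists>U. U \<subseteq> B \<and> S = \<Union>U"
    using univ_second_countable by blast
  obtain g :: "real \<Rightarrow> nat set" where g: "bij_betw g UNIV UNIV"
    using nat_sets_eqpoll_reals eqpoll_sym unfolding eqpoll_def by blast
  define K where "K t = - \<Union>{b \<in> B. to_nat_on B b \<in> g t}" for t
  show ?thesis
  proof
    show "closed (K t)" for t
      unfolding K_def using B(2) by auto
    fix C :: "'a set"
    assume "closed C"
    then obtain U where U: "U \<subseteq> B" "- C = \<Union>U"
      using B(3)[of "- C"] by auto
    obtain t where t: "g t = to_nat_on B ` U"
      using g by (metis bij_betw_imp_surj surjD)
    have "{b \<in> B. to_nat_on B b \<in> g t} = U"
      unfolding t using U(1) inj_on_to_nat_on[OF B(1)] by (auto dest: inj_onD)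
    then show "\<exists>t. K t = C"
      using U(2) unfolding K_def by (metis double_complement)
  qed
qed

text \<open>The Baire category theorem; it supplies the next point of the recursion.\<close>

lemma ex_not_in_countable_Union_nowhere_dense:
  fixes \<N> :: "real set set"
  assumes "countable \<N>" "\<And>N. N \<in> \<N> \<Longrightarrow> closed N \<and> interior N = {}"
  obtains y where "y \<notin> \<Union>\<N>"
proof -
  have "euclidean interior_of \<Union>\<N> = {}"
    by (rule Baire_category_alt)
      (use assms in \<open>auto simp: completely_metrizable_space_euclidean\<close>)
  then have "\<Union>\<N> \<noteq> UNIV"
    by (metis euclidean_interior_of interior_UNIV UNIV_not_empty)
  then show ?thesis
    using that by blast
qed

lemma interior_translation_empty:
  fixes S :: "real set"
  assumes "interior S = {}"
  shows "interior {y. y + a \<in> S} = {}"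
proof -
  have "{y. y + a \<in> S} = (+) (- a) ` S"
    by (force simp: image_iff)
  then show ?thesis
    using assms by (metis interior_translation image_empty)
qed

text \<open>The set \<open>E\<close> consists of the rational translates of points \<open>x t\<close> chosen by recursion along
  a well-order of the reals with countable initial segments. For every closed set \<open>K s\<close> of the
  plane with \<open>s\<close> not after \<open>t\<close>, the rational translates of \<open>x t\<close> avoid the vertical and
  horizontal sections of \<open>K s\<close> at earlier points, as long as these are nowhere dense; the
  diagonal sections take care of pairs of translates of the same \<open>x t\<close> and, with
  \<open>K s = N \<times> UNIV\<close>, of the Luzin property. An antitone set has only countably many sections
  that are not nowhere dense.\<close>

lemma CH_ex_Luzin_set:
  assumes "continuum_hypothesis"
  obtains E :: "real set" where
    "uncountable E"
    "\<And>z q. z \<in> E \<Longrightarrow> q \<in> \<rat> \<Longrightarrow> z + q \<in> E"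
    "\<And>N. closed N \<Longrightarrow> interior N = {} \<Longrightarrow> countable (E \<inter> N)"
    "\<And>K. closed K \<Longrightarrow> antitone_rel K \<Longrightarrow>
      \<exists>H. countable H \<and> E \<times> E \<inter> K \<subseteq> H \<times> UNIV \<union> UNIV \<times> H"
proof -
  obtain K :: "real \<Rightarrow> (real \<times> real) set" where
    closed_K: "\<And>s. closed (K s)" and K_surj: "\<And>C. closed C \<Longrightarrow> \<exists>s. K s = C"
    using closed_sets_parametrization by blast
  define r where "r = |UNIV :: real set|"
  have CO: "Card_order r" and Field_r: "Field r = UNIV"
    unfolding r_def by (rule card_of_Card_order, rule Field_card_of)
  have WO: "Well_order r"
    using CO by (simp add: card_order_on_def)
  \<comment> \<open>Proper initial segments of the cardinal order \<open>r\<close> are smaller than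
    \<open>r\<close>, which is \<aleph>_1 by CH.\<close>
  have countable_underS: "countable (underS r t)" for t
  proof -
    have "|underS r t| <o r"
      using card_of_underS[OF CO] Field_r by blast
    also have "r =o cardSuc natLeq"
      using assms unfolding continuum_hypothesis_def r_def .
    finally show ?thesis
      by (simp only: cardSuc_ordLeq_ordLess[OF natLeq_Card_order card_of_Card_order]
        countable_card_le_natLeq)
  qed
  have total: "s = t \<or> s \<in> underS r t \<or> t \<in> underS r s" for s t
    using WO Field_r unfolding underS_def well_order_on_def linear_order_on_def total_on_def
    by auto
  define bad where "bad f t =
      (\<Union>s\<in>insert t (underS r t). \<Union>u\<in>underS r t. \<Union>p\<in>\<rat>. \<Union>q\<in>\<rat>.
        {{y. y + q \<in> K s `` {f u + p}}, {y. y + q \<in> (K s)\<inverse> `` {f u + p}}}) \<union>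
      (\<Union>s\<in>insert t (underS r t). \<Union>p\<in>\<rat>. \<Union>q\<in>\<rat>. {{y. (y + p, y + q) \<in> K s}})"
    for f :: "real \<Rightarrow> real" and t
  have "\<exists>x. \<forall>t. \<forall>N\<in>bad x t. interior N = {} \<longrightarrow> x t \<notin> N"
  proof (rule dependent_wf_choice[of "r - Id"])
    show "wf (r - Id)"
      using WO by (simp add: well_order_on_def)
  next
    fix f g :: "real \<Rightarrow> real" and t y
    assume "\<And>z. (z, t) \<in> r - Id \<Longrightarrow> f z = g z"
    then have "f u = g u" if "u \<in> underS r t" for u
      using that by (auto simp: underS_def)
    then have "bad f t = bad g t"
      unfolding bad_def by (intro arg_cong2[where f = "(\<union>)"] SUP_cong refl) simp
    then show "(\<forall>N\<in>bad f t. interior N = {} \<longrightarrow> y \<notin> N) \<longleftrightarrow> (\<forall>N\<in>bad g t. interior N = {} \<longrightarrow> y \<notin> N)"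
      by simp
  next
    fix f :: "real \<Rightarrow> real" and t
    have countable_bad: "countable (bad f t)"
      unfolding bad_def by (intro countable_Un countable_UN countable_insert countable_underS
          countable_rat countable_empty)
    have closed_bad: "closed N" if "N \<in> bad f t" for N
    proof -
      have "closed {y. (g y, h y) \<in> K s}"
        if "continuous_on UNIV g" "continuous_on UNIV h" for g h :: "real \<Rightarrow> real" and s
        using closed_vimage[OF closed_K[of s], of "\<lambda>y. (g y, h y)"] that
        by (simp add: vimage_def continuous_on_Pair)
      then have "closed {y. (a, y + q) \<in> K s}" "closed {y. (y + q, a) \<in> K s}"
        "closed {y. (y + p, y + q) \<in> K s}" for a p q s
        by (simp_all add: continuous_intros)
      then show ?thesis
        using that unfolding bad_def by auto
    qed
    have "countable {N \<in> bad f t. interior N = {}}"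
      by (rule countable_subset[OF _ countable_bad]) blast
    then obtain y where "y \<notin> \<Union>{N \<in> bad f t. interior N = {}}"
      by (rule ex_not_in_countable_Union_nowhere_dense) (use closed_bad in auto)
    then show "\<exists>y. \<forall>N\<in>bad f t. interior N = {} \<longrightarrow> y \<notin> N"
      by blast
  qed
  then obtain x where x: "\<And>t N. N \<in> bad x t \<Longrightarrow> interior N = {} \<Longrightarrow> x t \<notin> N"
    by blast
  have diag: "(x t + p, x t + q) \<notin> K s"
    if "s \<in> insert t (underS r t)" "p \<in> \<rat>" "q \<in> \<rat>" "interior {y. (y + p, y + q) \<in> K s} = {}"
    for s t p q
    using x[of "{y. (y + p, y + q) \<in> K s}" t] that unfolding bad_def by blast
  have vert: "(x u + p, x t + q) \<notin> K s"
    if "s \<in> insert t (underS r t)" "u \<in> underS r t" "p \<in> \<rat>" "q \<in> \<rat>"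
      "interior (K s `` {x u + p}) = {}" for s t u p q
    using x[of "{y. y + q \<in> K s `` {x u + p}}" t] that
      interior_translation_empty[OF that(5)] unfolding bad_def by blast
  have horiz: "(x t + q, x u + p) \<notin> K s"
    if "s \<in> insert t (underS r t)" "u \<in> underS r t" "p \<in> \<rat>" "q \<in> \<rat>"
      "interior ((K s)\<inverse> `` {x u + p}) = {}" for s t u p q
    using x[of "{y. y + q \<in> (K s)\<inverse> `` {x u + p}}" t] that
      interior_translation_empty[OF that(5)] unfolding bad_def by blast
  define E where "E = (\<lambda>(t, q). x t + q) ` (UNIV \<times> \<rat>)"
  have countable_early: "countable ((\<lambda>(t, q). x t + q) ` (underS r s \<times> \<rat>))" for s
    by (intro countable_image countable_SIGMA countable_underS countable_rat)
  have Luzin: "countable (E \<inter> N)" if N: "closed N" "interior N = {}" for N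
  proof -
    obtain s where s: "K s = N \<times> UNIV"
      using K_surj[of "N \<times> UNIV"] N(1) by (auto simp: closed_Times)
    \<comment> \<open>With equal shifts the diagonal section of \<open>K s\<close> is a translate of
      \<open>N\<close>, so \<open>x t + q\<close> avoids \<open>N\<close> unless \<open>t\<close>
      comes before \<open>s\<close>.\<close>
    have "t \<in> underS r s" if "x t + q \<in> N" "q \<in> \<rat>" for t q
      using diag[of s t q q] total[of s t] that interior_translation_empty[OF N(2), of q]
      by (auto simp: s)
    then have "E \<inter> N \<subseteq> (\<lambda>(t, q). x t + q) ` (underS r s \<times> \<rat>)"
      unfolding E_def by fast
    then show ?thesis
      using countable_early countable_subset by blast
  qed
  have x_in_E: "x t \<in> E" for t
    unfolding E_def by (rule image_eqI[of _ _ "(t, 0)"]) auto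
  have "uncountable E"
  proof
    assume "countable E"
    \<comment> \<open>Single points are closed and nowhere dense, so each fibre of \<open>x\<close>
      lies in an initial segment; countably many fibres cannot exhaust the reals.\<close>
    then have "countable (\<Union>c\<in>E. {t. x t = c})"
    proof (rule countable_UN)
      fix c
      obtain s where s: "K s = {c} \<times> UNIV"
        using K_surj[of "{c} \<times> UNIV"] by (auto simp: closed_Times)
      have "{t. x t = c} \<subseteq> underS r s"
        using diag[of s _ 0 0] total[of s] by (auto simp: s)
      then show "countable {t. x t = c}"
        using countable_underS by (rule countable_subset)
    qed
    moreover have "(\<Union>c\<in>E. {t. x t = c}) = UNIV"
      using x_in_E by auto
    ultimately show False
      using uncountable_UNIV_real by simp
  qed
  moreover have "z + q \<in> E" if z: "z \<in> E" and q: "q \<in> \<rat>" for z q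
  proof -
    obtain t p where "z = x t + p" "p \<in> \<rat>"
      using z unfolding E_def by auto
    then show ?thesis
      unfolding E_def using q by (intro image_eqI[of _ _ "(t, p + q)"]) auto
  qed
  moreover have "\<exists>H. countable H \<and> E \<times> E \<inter> C \<subseteq> H \<times> UNIV \<union> UNIV \<times> H"
    if C: "closed C" "antitone_rel C" for C
  proof -
    obtain s where s: "K s = C"
      using K_surj C(1) by blast
    define H where "H = (\<lambda>(t, q). x t + q) ` (underS r s \<times> \<rat>) \<union>
      {h. interior (C `` {h}) \<noteq> {}} \<union> {h. interior (C\<inverse> `` {h}) \<noteq> {}}"
    have "countable H"
      unfolding H_def using C(2) antitone_rel_converse
      by (intro countable_Un countable_early antitone_rel_countable_fat_sections) auto
    moreover have "x u + p \<in> H \<or> x v + q \<in> H"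
      if pq: "p \<in> \<rat>" "q \<in> \<rat>" and in_C: "(x u + p, x v + q) \<in> C" for u v p q
    proof -
      have early: "x t + q \<in> H" if "t \<in> underS r s" "q \<in> \<rat>" for t q
        using that unfolding H_def by force
      \<comment> \<open>The later index decides. If it precedes \<open>s\<close>, its point is in
        \<open>H\<close>; otherwise its choice avoided the section at the earlier point unless that
        section is fat, and then the earlier point is in \<open>H\<close>.\<close>
      consider "u = v" | "u \<in> underS r v" | "v \<in> underS r u"
        using total by blast
      then show ?thesis
      proof cases
        case 1
        then have "u \<in> underS r s"
          using diag[of s u p q] total[of s u] pq in_C antitone_rel_thin_diagonal[OF C(2), of p q]
          by (auto simp: s)
        then show ?thesis
          using early pq by blast
      next
        case 2
        show ?thesis
          using vert[of s v u p q] total[of s v] 2 pq in_C early unfolding s H_def by blast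
      next
        case 3
        show ?thesis
          using horiz[of s u v q p] total[of s u] 3 pq in_C early unfolding s H_def by blast
      qed
    qed
    then have "E \<times> E \<inter> C \<subseteq> H \<times> UNIV \<union> UNIV \<times> H"
      unfolding E_def by fast
    ultimately show ?thesis
      by blast
  qed
  ultimately show ?thesis
    using that Luzin by blast
qed

section \<open>The Sorgenfrey line and its squares\<close>

lemma openin_sorgenfrey_line:
  "openin sorgenfrey_line U \<longleftrightarrow> (\<forall>x\<in>U. \<exists>e>0. {x..<x + e} \<subseteq> U)"
proof
  assume "openin sorgenfrey_line U"
  then have "generate_topology_on {{a..<b} |a b. True} U"
    unfolding sorgenfrey_line_def by (rule openin_topology_generated_by)
  then show "\<forall>x\<in>U. \<exists>e>0. {x..<x + e} \<subseteq> U"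
  proof induction
    case (Int U V)
    show ?case
    proof
      fix x
      assume "x \<in> U \<inter> V"
      then obtain d e where "d > 0" "{x..<x + d} \<subseteq> U" "e > 0" "{x..<x + e} \<subseteq> V"
        using Int.IH by blast
      moreover have "{x..<x + min d e} \<subseteq> {x..<x + d} \<inter> {x..<x + e}"
        by auto
      ultimately show "\<exists>e>0. {x..<x + e} \<subseteq> U \<inter> V"
        by (intro exI[of _ "min d e"] conjI) (simp, blast)
    qed
  next
    case (Basis U)
    then obtain a b where U: "U = {a..<b}"
      by auto
    show ?case
    proof
      fix x
      assume "x \<in> U"
      then show "\<exists>e>0. {x..<x + e} \<subseteq> U"
        unfolding U by (intro exI[of _ "b - x"]) auto
    qed
  next
    case (UN \<U>)
    then show ?case
      by (meson Union_iff Union_upper subset_trans)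
  qed simp
next
  assume "\<forall>x\<in>U. \<exists>e>0. {x..<x + e} \<subseteq> U"
  then obtain e where e: "\<And>x. x \<in> U \<Longrightarrow> e x > 0 \<and> {x..<x + e x} \<subseteq> U"
    by metis
  then have "U = (\<Union>x\<in>U. {x..<x + e x})"
    by force
  moreover have "openin sorgenfrey_line {x..<x + e x}" for x
    unfolding sorgenfrey_line_def by (rule topology_generated_by_Basis) blast
  then have "openin sorgenfrey_line (\<Union>x\<in>U. {x..<x + e x})"
    by (intro openin_Union) auto
  ultimately show "openin sorgenfrey_line U"
    by simp
qed

text \<open>Half-open intervals are clopen, so an interval and its complement separate a point from
  a closed set.\<close>

lemma regular_space_sorgenfrey_line: "regular_space sorgenfrey_line"
  unfolding regular_space_def
proof (intro allI impI, elim conjE)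
  fix C :: "real set" and a
  assume "closedin sorgenfrey_line C" and a: "a \<in> topspace sorgenfrey_line - C"
  then have "openin sorgenfrey_line (- C)"
    by (simp add: closedin_def Compl_eq_Diff_UNIV)
  then obtain e where e: "e > 0" "{a..<a + e} \<subseteq> - C"
    using a by (auto simp: openin_sorgenfrey_line)
  have "openin sorgenfrey_line {a..<a + e}"
    unfolding sorgenfrey_line_def by (rule topology_generated_by_Basis) blast
  moreover have "openin sorgenfrey_line (- {a..<a + e})"
    unfolding openin_sorgenfrey_line
  proof
    fix x
    assume "x \<in> - {a..<a + e}"
    then show "\<exists>d>0. {x..<x + d} \<subseteq> - {a..<a + e}"
      by (intro exI[of _ "if x < a then a - x else 1"]) auto
  qed
  moreover have "a \<in> {a..<a + e}" "C \<subseteq> - {a..<a + e}" "disjnt {a..<a + e} (- {a..<a + e})"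
    using e by (auto simp: disjnt_def)
  ultimately show "\<exists>U V. openin sorgenfrey_line U \<and> openin sorgenfrey_line V \<and>
      a \<in> U \<and> C \<subseteq> V \<and> disjnt U V"
    by blast
qed

section \<open>Countable subcovers and the Lindelof property of the square\<close>

lemma openin_sorgenfrey_square_box:
  assumes "openin (prod_topology (sorgenfrey_subspace E) (sorgenfrey_subspace E)) U" "p \<in> U"
  obtains e where "e > 0"
    "E \<times> E \<inter> {fst p..<fst p + e} \<times> {snd p..<snd p + e} \<subseteq> U"
proof -
  obtain V W where V: "openin (sorgenfrey_subspace E) V" and W: "openin (sorgenfrey_subspace E) W"
    and p: "fst p \<in> V" "snd p \<in> W" and VW: "V \<times> W \<subseteq> U"
    using assms unfolding openin_prod_topology_alt by (metis prod.collapse)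
  obtain V' W' where VW': "openin sorgenfrey_line V'" "V = V' \<inter> E"
      "openin sorgenfrey_line W'" "W = W' \<inter> E"
    using V W unfolding openin_subtopology by blast
  obtain d e where de: "d > 0" "{fst p..<fst p + d} \<subseteq> V'" "e > 0" "{snd p..<snd p + e} \<subseteq> W'"
    using VW' p unfolding openin_sorgenfrey_line by blast
  have "{fst p..<fst p + min d e} \<subseteq> {fst p..<fst p + d}"
    "{snd p..<snd p + min d e} \<subseteq> {snd p..<snd p + e}"
    by auto
  then have "{fst p..<fst p + min d e} \<subseteq> V'" "{snd p..<snd p + min d e} \<subseteq> W'"
    using de by blast+
  then have "E \<times> E \<inter> {fst p..<fst p + min d e} \<times> {snd p..<snd p + min d e} \<subseteq> V \<times> W"
    unfolding VW'(2,4) by blast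
  then show ?thesis
    using VW de by (intro that[of "min d e"] subset_trans[OF _ VW]) simp
qed

text \<open>The Euclidean Lindelof property handles points interior to some interval. For the
  remaining points \<open>R\<close> the open intervals are pairwise disjoint, so rationals chosen in
  them show that \<open>R\<close> is countable.\<close>

lemma sorgenfrey_countable_subcover:
  fixes e :: "real \<Rightarrow> real"
  assumes e: "\<And>y. y \<in> Y \<Longrightarrow> e y > 0"
  obtains Z where "countable Z" "Z \<subseteq> Y" "Y \<subseteq> (\<Union>y\<in>Z. {y..<y + e y})"
proof -
  have "open S" if "S \<in> (\<lambda>y. {y<..<y + e y}) ` Y" for S
    using that by auto
  then obtain \<F> where \<F>: "\<F> \<subseteq> (\<lambda>y. {y<..<y + e y}) ` Y" "countable \<F>"
      "\<Union>\<F> = (\<Union>y\<in>Y. {y<..<y + e y})"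
    by (rule Lindelof)
  obtain Z where Z: "countable Z" "Z \<subseteq> Y" "\<F> = (\<lambda>y. {y<..<y + e y}) ` Z"
    using countable_subset_image[THEN iffD1, OF conjI, OF \<F>(2,1)] by blast
  define R where "R = Y - (\<Union>y\<in>Y. {y<..<y + e y})"
  have "\<exists>q\<in>\<rat>. y < q \<and> q < y + e y" if "y \<in> R" for y
    using Rats_dense_in_real[of y "y + e y"] e that by (auto simp: R_def)
  then obtain f where f: "\<And>y. y \<in> R \<Longrightarrow> f y \<in> \<rat> \<and> y < f y \<and> f y < y + e y"
    by metis
  have neq: "f y \<noteq> f z" if yz: "y \<in> R" "z \<in> R" "y < z" for y z
  proof
    assume "f y = f z"
    then have "z \<in> {y<..<y + e y}"
      using f[OF yz(1)] f[OF yz(2)] yz(3) by auto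
    then show False
      using yz by (auto simp: R_def)
  qed
  have "inj_on f R"
    by (rule inj_onI) (metis neq linorder_neqE)
  moreover have "countable (f ` R)"
    using f by (intro countable_subset[OF _ countable_rat]) auto
  ultimately have "countable R"
    using countable_image_inj_on by blast
  moreover have "y \<in> (\<Union>y\<in>Z \<union> R. {y..<y + e y})" if "y \<in> Y" for y
  proof (cases "y \<in> R")
    case True
    then show ?thesis
      using e[OF that] by force
  next
    case False
    then have "y \<in> \<Union>\<F>"
      using that \<F>(3) by (auto simp: R_def)
    then show ?thesis
      unfolding Z(3) by force
  qed
  moreover have "R \<subseteq> Y"
    unfolding R_def by blast
  ultimately show ?thesis
    using Z(1,2) by (intro that[of "Z \<union> R"]) blast+
qed

text \<open>The points outside the union of the open boxes split into countably many sets \<open>S m\<close>, each of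
  smaller diameter than the boxes at its points; these sets are antitone, since otherwise one point
  would lie in the open box of another.\<close>

lemma sorgenfrey_square_countable_subcover:
  fixes e :: "real \<times> real \<Rightarrow> real"
  assumes lines: "\<And>K. closed K \<Longrightarrow> antitone_rel K \<Longrightarrow>
      \<exists>H. countable H \<and> E \<times> E \<inter> K \<subseteq> H \<times> UNIV \<union> UNIV \<times> H"
    and e: "\<And>p. p \<in> E \<times> E \<Longrightarrow> e p > 0"
  obtains P where "countable P" "P \<subseteq> E \<times> E"
    "E \<times> E \<subseteq> (\<Union>p\<in>P. {fst p..<fst p + e p} \<times> {snd p..<snd p + e p})"
proof -
  define box where "box p = {fst p..<fst p + e p} \<times> {snd p..<snd p + e p}" for p
  define obox where "obox p = {fst p<..<fst p + e p} \<times> {snd p<..<snd p + e p}" for p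
  have "open S" if "S \<in> obox ` (E \<times> E)" for S
    using that unfolding obox_def by (auto intro!: open_Times)
  then obtain \<F> where \<F>: "\<F> \<subseteq> obox ` (E \<times> E)" "countable \<F>" "\<Union>\<F> = (\<Union>p\<in>E \<times> E. obox p)"
    by (rule Lindelof)
  obtain P where P: "countable P" "P \<subseteq> E \<times> E" "\<F> = obox ` P"
    using countable_subset_image[THEN iffD1, OF conjI, OF \<F>(2,1)] by blast
  define R where "R = E \<times> E - (\<Union>p\<in>E \<times> E. obox p)"
  \<comment> \<open>\<open>n\<close> bounds the boxes from below, and \<open>i\<close>,
    \<open>j\<close> select a grid cell of side \<open>1 / Suc n\<close>, so that two points of a
    piece differ by less than either box size.\<close>
  define S where "S = (\<lambda>(n :: nat, i :: int, j :: int). {p \<in> R. 1 / real (Suc n) < e p \<and>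
    \<lfloor>fst p * real (Suc n)\<rfloor> = i \<and> \<lfloor>snd p * real (Suc n)\<rfloor> = j})"
  have close: "b < a + 1 / real (Suc n)"
    if "\<lfloor>a * real (Suc n)\<rfloor> = \<lfloor>b * real (Suc n)\<rfloor>" for a b :: real and n
  proof -
    have "b * real (Suc n) < a * real (Suc n) + 1"
      using that by linarith
    then show ?thesis
      by (simp add: field_simps)
  qed
  have "antitone_rel (S m)" for m
    unfolding antitone_rel_def
  proof (intro ballI notI)
    fix p q
    assume pq: "p \<in> S m" "q \<in> S m" and less: "fst p < fst q \<and> snd p < snd q"
    obtain n where n: "1 / real (Suc n) < e p" "\<lfloor>fst p * real (Suc n)\<rfloor> = \<lfloor>fst q * real (Suc n)\<rfloor>"
        "\<lfloor>snd p * real (Suc n)\<rfloor> = \<lfloor>snd q * real (Suc n)\<rfloor>" "p \<in> R" "q \<in> R"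
      using pq unfolding S_def by (auto split: prod.splits)
    have "fst q < fst p + e p" "snd q < snd p + e p"
      using close[OF n(2)] close[OF n(3)] n(1) by linarith+
    then have "q \<in> obox p"
      using less by (simp add: obox_def mem_Times_iff)
    then show False
      using n(4,5) unfolding R_def by blast
  qed
  then have "\<exists>H. countable H \<and> E \<times> E \<inter> closure (S m) \<subseteq> H \<times> UNIV \<union> UNIV \<times> H" for m
    by (intro lines closed_closure antitone_rel_closure)
  then obtain H where H: "\<And>m. countable (H m)"
      "\<And>m. E \<times> E \<inter> closure (S m) \<subseteq> H m \<times> UNIV \<union> UNIV \<times> H m"
    by metis
  have R: "fst p \<in> (\<Union>m. H m) \<or> snd p \<in> (\<Union>m. H m)" if p: "p \<in> R" for p
  proof -
    obtain n where "1 / real (Suc n) < e p"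
      using p e unfolding R_def by (meson DiffD1 nat_approx_posE)
    then have "p \<in> S (n, \<lfloor>fst p * real (Suc n)\<rfloor>, \<lfloor>snd p * real (Suc n)\<rfloor>)"
      using p unfolding S_def by simp
    then have "\<exists>m. p \<in> E \<times> E \<inter> closure (S m)"
      using p closure_subset unfolding R_def by blast
    then show ?thesis
      using H(2) by fastforce
  qed
  \<comment> \<open>Boxes based on a horizontal or vertical line trace half-open intervals on it, so
    the one-dimensional lemma covers both lines through \<open>h\<close>.\<close>
  have "\<exists>Q. countable Q \<and> Q \<subseteq> E \<times> E \<and> {h} \<times> E \<union> E \<times> {h} \<subseteq> (\<Union>p\<in>Q. box p)"
    if h: "h \<in> E" for h
  proof -
    have pos: "e (h, y) > 0" "e (y, h) > 0" if "y \<in> E" for y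
      using e h that by blast+
    obtain Z1 where Z1: "countable Z1" "Z1 \<subseteq> E" "E \<subseteq> (\<Union>y\<in>Z1. {y..<y + e (h, y)})"
      using pos(1) by (rule sorgenfrey_countable_subcover)
    obtain Z2 where Z2: "countable Z2" "Z2 \<subseteq> E" "E \<subseteq> (\<Union>y\<in>Z2. {y..<y + e (y, h)})"
      using pos(2) by (rule sorgenfrey_countable_subcover)
    have "(h, y) \<in> (\<Union>p\<in>{h} \<times> Z1. box p)" if "y \<in> E" for y
    proof -
      obtain z where z: "z \<in> Z1" "y \<in> {z..<z + e (h, z)}"
        using Z1(3) \<open>y \<in> E\<close> by blast
      moreover have "e (h, z) > 0"
        using z(1) Z1(2) pos(1) by blast
      ultimately show ?thesis
        by (intro UN_I[of "(h, z)"]) (simp_all add: box_def)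
    qed
    moreover have "(y, h) \<in> (\<Union>p\<in>Z2 \<times> {h}. box p)" if "y \<in> E" for y
    proof -
      obtain z where z: "z \<in> Z2" "y \<in> {z..<z + e (z, h)}"
        using Z2(3) \<open>y \<in> E\<close> by blast
      moreover have "e (z, h) > 0"
        using z(1) Z2(2) pos(2) by blast
      ultimately show ?thesis
        by (intro UN_I[of "(z, h)"]) (simp_all add: box_def)
    qed
    ultimately have "{h} \<times> E \<union> E \<times> {h} \<subseteq> (\<Union>p\<in>{h} \<times> Z1 \<union> Z2 \<times> {h}. box p)"
      by blast
    moreover have "countable ({h} \<times> Z1 \<union> Z2 \<times> {h})" "{h} \<times> Z1 \<union> Z2 \<times> {h} \<subseteq> E \<times> E"
      using Z1(1,2) Z2(1,2) h by auto
    ultimately show ?thesis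
      by blast
  qed
  then obtain Q where Q: "\<And>h. h \<in> E \<Longrightarrow> countable (Q h) \<and> Q h \<subseteq> E \<times> E \<and>
      {h} \<times> E \<union> E \<times> {h} \<subseteq> (\<Union>p\<in>Q h. box p)"
    by metis
  define P' where "P' = P \<union> (\<Union>h\<in>E \<inter> (\<Union>m. H m). Q h)"
  have "countable P'"
    unfolding P'_def using P(1) H(1) Q
    by (intro countable_Un countable_UN countable_Int2 countableI_type) auto
  moreover have "P' \<subseteq> E \<times> E"
    unfolding P'_def using P(2) Q by blast
  moreover have "p \<in> (\<Union>p\<in>P'. box p)" if p: "p \<in> E \<times> E" for p
  proof (cases "p \<in> R")
    case True
    then obtain h where h: "h \<in> E \<inter> (\<Union>m. H m)" "p \<in> {h} \<times> E \<union> E \<times> {h}"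
      using R[OF True] p by (auto simp: mem_Times_iff)
    then have "p \<in> (\<Union>p\<in>Q h. box p)"
      using Q[of h] by blast
    then show ?thesis
      using h(1) unfolding P'_def by blast
  next
    case False
    then have "p \<in> \<Union>\<F>"
      using p \<F>(3) unfolding R_def by blast
    moreover have "obox q \<subseteq> box q" for q
      unfolding obox_def box_def by auto
    ultimately show ?thesis
      unfolding P(3) P'_def by blast
  qed
  ultimately show ?thesis
    by (intro that[of P', folded box_def] subsetI[of "E \<times> E"])
qed

text \<open>Each point gets a box whose trace on the square lies in a member of the cover; a
  countable subfamily of boxes then selects countably many members.\<close>

lemma Lindelof_sorgenfrey_square:
  assumes "\<And>K. closed K \<Longrightarrow> antitone_rel K \<Longrightarrow>
      \<exists>H. countable H \<and> E \<times> E \<inter> K \<subseteq> H \<times> UNIV \<union> UNIV \<times> H"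
  shows "Lindelof_space (prod_topology (sorgenfrey_subspace E) (sorgenfrey_subspace E))"
    (is "Lindelof_space ?X")
  unfolding Lindelof_space_def
proof (intro allI impI, elim conjE)
  fix \<U>
  assume op: "\<forall>U\<in>\<U>. openin ?X U" and cover: "\<Union>\<U> = topspace ?X"
  have top: "topspace ?X = E \<times> E"
    by (simp only: topspace_prod_topology topspace_subtopology topspace_sorgenfrey_line Int_UNIV_left)
  have "\<exists>U e. U \<in> \<U> \<and> e > 0 \<and> E \<times> E \<inter> {fst p..<fst p + e} \<times> {snd p..<snd p + e} \<subseteq> U"
    if p: "p \<in> E \<times> E" for p
  proof -
    obtain U where U: "U \<in> \<U>" "p \<in> U"
      using p unfolding top[symmetric] cover[symmetric] by (rule UnionE)
    obtain e where "e > 0" "E \<times> E \<inter> {fst p..<fst p + e} \<times> {snd p..<snd p + e} \<subseteq> U"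
      using op[rule_format, OF U(1)] U(2) by (rule openin_sorgenfrey_square_box)
    then show ?thesis
      using U(1) by (intro exI conjI)
  qed
  then obtain U e where U: "\<And>p. p \<in> E \<times> E \<Longrightarrow> U p \<in> \<U>"
    and e: "\<And>p. p \<in> E \<times> E \<Longrightarrow> e p > 0"
    and box: "\<And>p. p \<in> E \<times> E \<Longrightarrow>
      E \<times> E \<inter> {fst p..<fst p + e p} \<times> {snd p..<snd p + e p} \<subseteq> U p"
    by metis
  obtain P where P: "countable P" "P \<subseteq> E \<times> E"
      "E \<times> E \<subseteq> (\<Union>p\<in>P. {fst p..<fst p + e p} \<times> {snd p..<snd p + e p})"
    using assms e by (rule sorgenfrey_square_countable_subcover)
  have sub: "U ` P \<subseteq> \<U>"
    using P(2) U by (intro image_subsetI) (rule U, rule subsetD)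
  have "E \<times> E \<subseteq> \<Union>(U ` P)"
  proof
    fix q
    assume q: "q \<in> E \<times> E"
    obtain p where p: "p \<in> P" "q \<in> {fst p..<fst p + e p} \<times> {snd p..<snd p + e p}"
      using subsetD[OF P(3) q] by (rule UN_E)
    have "q \<in> U p"
      using subsetD[OF P(2) p(1)] q p(2) by (intro subsetD[OF box] IntI)
    then show "q \<in> \<Union>(U ` P)"
      using p(1) by (rule UN_I[rotated])
  qed
  moreover have "\<Union>(U ` P) \<subseteq> E \<times> E"
    using Union_mono[OF sub] unfolding cover top .
  ultimately have "\<Union>(U ` P) = topspace ?X"
    unfolding top by (intro antisym)
  then show "\<exists>\<V>. countable \<V> \<and> \<V> \<subseteq> \<U> \<and> \<Union>\<V> = topspace ?X"
    using sub countable_image[OF P(1)] by (intro exI conjI)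
qed

lemma normal_space_sorgenfrey_square:
  assumes "\<And>K. closed K \<Longrightarrow> antitone_rel K \<Longrightarrow>
      \<exists>H. countable H \<and> E \<times> E \<inter> K \<subseteq> H \<times> UNIV \<union> UNIV \<times> H"
  shows "normal_space (prod_topology (sorgenfrey_subspace E) (sorgenfrey_subspace E))"
proof (rule regular_Lindelof_imp_normal_space)
  show "regular_space (prod_topology (sorgenfrey_subspace E) (sorgenfrey_subspace E))"
    unfolding regular_space_prod_topology
    using regular_space_subtopology[OF regular_space_sorgenfrey_line] by blast
  show "Lindelof_space (prod_topology (sorgenfrey_subspace E) (sorgenfrey_subspace E))"
    using assms by (rule Lindelof_sorgenfrey_square)
qed

section \<open>Luzin sets and entangledness\<close>

text \<open>The complement of an open superset of a dense set is closed and nowhere dense.\<close>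

lemma Luzin_set_concentrated:
  assumes Luzin: "\<And>N. closed N \<Longrightarrow> interior N = {} \<Longrightarrow> countable (E \<inter> N)"
    and dense: "closure D = UNIV"
  shows "concentrated_on E D"
  unfolding concentrated_on_def
proof (intro allI impI, elim conjE)
  fix U :: "real set"
  assume "open U" and "D \<subseteq> U"
  have "closure U = UNIV"
    using closure_mono[OF \<open>D \<subseteq> U\<close>] dense by auto
  then have "interior (- U) = {}"
    by (simp add: interior_complement)
  with \<open>open U\<close> have "countable (E \<inter> - U)"
    by (intro Luzin) auto
  then show "countable (E - U)"
    by (simp add: Diff_eq)
qed

text \<open>If \<open>D\<close> were \<open>E\<close> intersected with countably many open sets,
  each of them would contain \<open>D\<close> and so miss only countably many points of
  \<open>E\<close>, making \<open>E\<close> countable.\<close>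

lemma concentrated_not_lambda_set:
  assumes conc: "concentrated_on E D" and D: "countable D" "D \<subseteq> E" and E: "uncountable E"
  shows "\<not> lambda_set E"
proof
  assume "lambda_set E"
  then have "gdelta_in (top_of_set E) D"
    using D unfolding lambda_set_def by blast
  then obtain T where T: "gdelta_in euclidean T" "D = T \<inter> E"
    unfolding gdelta_in_subtopology by blast
  then obtain \<G> where \<G>: "countable \<G>" "\<And>G. G \<in> \<G> \<Longrightarrow> open G" "\<Inter>\<G> = T"
    unfolding gdelta_in_alt intersection_of_def by auto
  have "countable (E - G)" if "G \<in> \<G>" for G
    using conc \<G>(2)[OF that] \<G>(3) T(2) that unfolding concentrated_on_def by blast
  then have "countable (D \<union> (\<Union>G\<in>\<G>. E - G))"
    using D(1) \<G>(1) by (intro countable_Un countable_UN)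
  moreover have "E \<subseteq> D \<union> (\<Union>G\<in>\<G>. E - G)"
    using T(2) \<G>(3) by blast
  ultimately show False
    using E countable_subset by blast
qed

lemma Q_set_imp_lambda_set: "Q_set X \<Longrightarrow> lambda_set X"
  unfolding Q_set_def lambda_set_def by blast

text \<open>Stated for images because it is applied to a set of lists, whose cardinality is bounded
  through its parametrization by reals.\<close>

lemma CH_uncountable_ordIso:
  fixes f :: "real \<Rightarrow> 'a"
  assumes "continuum_hypothesis" "uncountable (f ` X)"
  shows "|f ` X| =o cardSuc natLeq"
proof -
  have "|f ` X| \<le>o |UNIV :: real set|"
    using card_of_image card_of_mono1[OF subset_UNIV] by (rule ordLeq_transitive)
  then have "|f ` X| \<le>o cardSuc natLeq"
    using assms(1) unfolding continuum_hypothesis_def by (rule ordLeq_ordIso_trans)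
  moreover have "natLeq <o |f ` X|"
    using assms(2) unfolding countable_card_le_natLeq
      not_ordLeq_iff_ordLess[OF natLeq_Well_order card_of_Well_order] .
  then have "cardSuc natLeq \<le>o |f ` X|"
    unfolding cardSuc_ordLess_ordLeq[OF natLeq_Card_order card_of_Card_order] .
  ultimately show ?thesis
    unfolding ordIso_iff_ordLeq by (rule conjI)
qed

text \<open>The translation by 1 is increasing, so no two pairs \<open>[z, z + 1]\<close> realize the type \<open>(0, 1)\<close>;
  restricting \<open>z\<close> to \<open>[0, 1)\<close> makes the pairs disjoint.\<close>

lemma translation_invariant_not_entangled:
  assumes CH: "continuum_hypothesis" and E: "uncountable E"
    and shift: "\<And>z q. z \<in> E \<Longrightarrow> q \<in> \<rat> \<Longrightarrow> z + q \<in> E"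
  shows "\<not> entangled 2 E"
proof
  assume ent: "entangled 2 E"
  define X where "X = E \<inter> {0..<1}"
  define A where "A = (\<lambda>z. [z, z + 1]) ` X"
  \<comment> \<open>Countably many integer translates of \<open>X\<close> cover \<open>E\<close>, so
    \<open>X\<close> is still uncountable.\<close>
  have "E \<subseteq> (\<Union>k. (\<lambda>z. z + real_of_int k) ` X)"
  proof
    fix z
    assume "z \<in> E"
    then have "frac z \<in> E"
      using shift[of z "- of_int \<lfloor>z\<rfloor>"] by (simp add: frac_def)
    then have "frac z \<in> X"
      by (simp add: X_def frac_lt_1)
    moreover have "z = frac z + \<lfloor>z\<rfloor>"
      by (simp add: frac_def)
    ultimately show "z \<in> (\<Union>k. (\<lambda>z. z + real_of_int k) ` X)"
      by blast
  qed
  then have "uncountable X"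
    using E by (meson countableI_type countable_UN countable_image countable_subset)
  moreover have "inj_on (\<lambda>z :: real. [z, z + 1]) X"
    by (simp add: inj_on_def)
  ultimately have "uncountable A"
    unfolding A_def using countable_image_inj_on by blast
  then have "|A| =o cardSuc natLeq"
    using CH_uncountable_ordIso[OF CH] unfolding A_def by blast
  moreover have "A \<subseteq> increasing_tuples E 2"
    using shift[of _ 1] unfolding A_def X_def increasing_tuples_def by auto
  moreover have "pairwise (\<lambda>x y. disjnt (set x) (set y)) A"
    unfolding A_def X_def pairwise_def disjnt_def by auto
  ultimately obtain x y where xy: "x \<in> A" "y \<in> A" "x \<noteq> y"
      "\<forall>i<2. x ! i < y ! i \<longleftrightarrow> [0, 1 :: nat] ! i = 0"
    using ent[unfolded entangled_def, rule_format, of A "[0, 1]"] by auto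
  have "x ! 0 < y ! 0" "\<not> x ! 1 < y ! 1"
    using xy(4)[rule_format, of 0] xy(4)[rule_format, of 1] by simp_all
  then show False
    using xy(1,2) unfolding A_def by auto
qed

theorem theorem2p12:
  assumes "continuum_hypothesis"
  shows "\<exists>E :: real set.
    \<not> entangled 2 E \<and>
    concentrated_on E \<rat> \<and> \<not> Q_set E \<and> \<not> lambda_set E \<and>
    normal_space (prod_topology (sorgenfrey_subspace E) (sorgenfrey_subspace E))"
proof -
  obtain E where E: "uncountable E" "\<And>z q. z \<in> E \<Longrightarrow> q \<in> \<rat> \<Longrightarrow> z + q \<in> E"
    and Luzin: "\<And>N. closed N \<Longrightarrow> interior N = {} \<Longrightarrow> countable (E \<inter> N)"
    and lines: "\<And>K. closed K \<Longrightarrow> antitone_rel K \<Longrightarrow>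
      \<exists>H. countable H \<and> E \<times> E \<inter> K \<subseteq> H \<times> UNIV \<union> UNIV \<times> H"
    using CH_ex_Luzin_set[OF assms] by metis
  obtain z where z: "z \<in> E"
    using E(1) by fastforce
  \<comment> \<open>A countable dense subset of \<open>E\<close> itself is required to refute the
    \<lambda>-property, and \<rat> is not known to lie in \<open>E\<close>; a rational coset of a
    point of \<open>E\<close> does.\<close>
  have "closure ((+) z ` \<rat>) = UNIV"
    by (simp add: closure_translation Rats_closure_real)
  then have "concentrated_on E ((+) z ` \<rat>)"
    using Luzin Luzin_set_concentrated by blast
  moreover have "(+) z ` \<rat> \<subseteq> E" "countable ((+) z ` \<rat>)"
    using E(2) z countable_rat by auto
  ultimately have "\<not> lambda_set E"
    using concentrated_not_lambda_set E(1) by blast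
  moreover have "concentrated_on E \<rat>"
    by (rule Luzin_set_concentrated) (auto intro: Luzin simp: Rats_closure_real)
  ultimately show ?thesis
    using translation_invariant_not_entangled[OF assms E] Q_set_imp_lambda_set
      normal_space_sorgenfrey_square[OF lines] by blast
qed

end
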